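(* Let $n\ge 1$, $a$, $k\ge 1$, $d\ge 1$ be integers, and let $K_{n,n}$ be the complete bipartite graph with both parts of size $n$. Suppose the equation $ax+(a+1)y=n$ has two solutions $(x_1,y_1)$ and $(x_2,y_2)$ in nonnegative integers (not necessarily different), and put $z_1=x_1+y_1$, $z_2=x_2+y_2$. Then $K_{n,n}$ has an equitable $(z_1+z_2,k,d)$-tree-coloring in which every color class has size either $a$ or $a+1$.
   Context: A $t$-coloring of a graph $G$ is a map $f:V(G)\to\{1,\dots,t\}$ (not necessarily surjective) with color classes $V_i=f^{-1}(i)$; it is equitable if $||V_i|-|V_j||\le 1$ for all $i,j$. It is a $(t,k,d)$-tree-coloring if for every $i$, each connected component of $G[V_i]$ is a tree of maximum degree at most $k$ and diameter at most $d$. *)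

theory Defs
  imports "Graph_Theory.Graph_Theory"
begin

text \<open>
  Finite simple graphs are the symmetric digraphs of the locale \<^locale>\<open>graph\<close>: an undirected
  edge is a pair of opposite arcs. The library's \<^const>\<open>forest\<close> and \<^const>\<open>tree\<close> are not usable for
  these, because going back and forth along one edge is a \<^const>\<open>pre_digraph.cycle\<close> of length 2. In a
  loop-free graph without parallel arcs, the undirected cycles are the cycles of length at least 3.
\<close>

definition undirected_forest :: "('a, 'b) pre_digraph \<Rightarrow> bool" where
  "undirected_forest G \<longleftrightarrow> \<not> (\<exists>p. pre_digraph.cycle G p \<and> 3 \<le> length p)"

definition undirected_tree :: "('a, 'b) pre_digraph \<Rightarrow> bool" where
  "undirected_tree G \<longleftrightarrow> connected G \<and> undirected_forest G"

text \<open>In a symmetric digraph the out-degree of a vertex is its degree in the undirected sense.\<close>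

definition max_degree :: "('a, 'b) pre_digraph \<Rightarrow> nat" where
  "max_degree G = Max (out_degree G ` verts G)"

definition diameter :: "('a, 'b) pre_digraph \<Rightarrow> ereal" where
  "diameter G = (SUP u\<in>verts G. SUP v\<in>verts G. wf_digraph.\<mu> G (\<lambda>_. 1) u v)"

definition color_class :: "('a, 'b) pre_digraph \<Rightarrow> ('a \<Rightarrow> nat) \<Rightarrow> nat \<Rightarrow> 'a set" where
  "color_class G f i = {v \<in> verts G. f v = i}"

definition coloring :: "('a, 'b) pre_digraph \<Rightarrow> nat \<Rightarrow> ('a \<Rightarrow> nat) \<Rightarrow> bool" where
  "coloring G t f \<longleftrightarrow> f ` verts G \<subseteq> {1..t}"

definition equitable :: "('a, 'b) pre_digraph \<Rightarrow> nat \<Rightarrow> ('a \<Rightarrow> nat) \<Rightarrow> bool" where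
  "equitable G t f \<longleftrightarrow> (\<forall>i\<in>{1..t}. \<forall>j\<in>{1..t}.
     \<bar>int (card (color_class G f i)) - int (card (color_class G f j))\<bar> \<le> 1)"

text \<open>
  The strongly connected components of a symmetric digraph, \<^const>\<open>pre_digraph.sccs\<close>, are the
  connected components of the undirected graph.
\<close>

definition tree_coloring ::
  "('a, 'b) pre_digraph \<Rightarrow> nat \<Rightarrow> nat \<Rightarrow> nat \<Rightarrow> ('a \<Rightarrow> nat) \<Rightarrow> bool" where
  "tree_coloring G t k d f \<longleftrightarrow> coloring G t f \<and>
     (\<forall>i\<in>{1..t}. \<forall>H\<in>pre_digraph.sccs (G \<restriction> color_class G f i).
        undirected_tree H \<and> max_degree H \<le> k \<and> diameter H \<le> ereal (real d))"

end

theory Submission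
  imports Defs
begin

text \<open>
  Split each part of \<open>K\<^bsub>n,n\<^esub>\<close> separately, the \<open>i\<close>-th part into \<open>x\<^sub>i\<close> classes of size \<open>a\<close> and
  \<open>y\<^sub>i\<close> classes of size \<open>a + 1\<close>, using disjoint palettes for the two parts. Every color class is
  then independent, so the components it induces are single vertices.
\<close>

text \<open>Induction on \<open>I\<close>, with \<open>S\<close> varying: a subset of size
  \<open>s j\<close> is carved out as the fibre of the new index \<open>j\<close>, and the induction
  hypothesis distributes the remainder over \<open>I\<close>.\<close>

lemma exists_map_with_fibre_cards:
  fixes s :: "'i \<Rightarrow> nat"
  assumes "finite I" "finite S" "card S = (\<Sum>i\<in>I. s i)"
  shows "\<exists>f. f ` S \<subseteq> I \<and> (\<forall>i\<in>I. card {v \<in> S. f v = i} = s i)"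
  using assms
proof (induction I arbitrary: S rule: finite_induct)
  case empty
  then show ?case by simp
next
  case (insert j I)
  then have "s j \<le> card S" by simp
  then obtain T where T: "T \<subseteq> S" "card T = s j"
    using obtain_subset_with_card_n by metis
  then have "card (S - T) = (\<Sum>i\<in>I. s i)"
    using insert by (simp add: card_Diff_subset finite_subset)
  then obtain f where f: "f ` (S - T) \<subseteq> I" "\<forall>i\<in>I. card {v \<in> S - T. f v = i} = s i"
    using insert.IH[of "S - T"] insert.prems by auto
  let ?g = "\<lambda>v. if v \<in> T then j else f v"
  \<comment> \<open>No point outside \<open>T\<close> is sent to \<open>j\<close>, since
    \<open>f\<close> maps \<open>S - T\<close> into \<open>I\<close> and \<open>j\<close> is not in
    \<open>I\<close>.\<close>
  have "{v \<in> S. ?g v = j} = T"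
    using T f(1) insert.hyps by auto
  moreover have "{v \<in> S. ?g v = i} = {v \<in> S - T. f v = i}" if "i \<in> I" for i
    using that insert.hyps by auto
  moreover have "?g ` S \<subseteq> insert j I"
    using f(1) by auto
  ultimately show ?case
    using T(2) f(2) by (intro exI[of _ ?g]) simp
qed

text \<open>The offset \<open>m\<close> shifts the palette, so that the two parts of the graph can
  be colored with disjoint sets of colors.\<close>

lemma exists_near_equal_partition:
  fixes a :: int
  assumes "finite S" "0 \<le> a" "a * int x + (a + 1) * int y = int (card S)"
  shows "\<exists>f. f ` S \<subseteq> {m + 1..m + (x + y)} \<and>
    (\<forall>i\<in>{m + 1..m + (x + y)}. int (card {v \<in> S. f v = i}) \<in> {a, a + 1})"
proof -
  \<comment> \<open>The first \<open>x\<close> colors of the palette get classes of size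
    \<open>a\<close>, the remaining \<open>y\<close> get size \<open>a + 1\<close>.\<close>
  let ?s = "\<lambda>i. if i \<le> m + x then nat a else nat a + 1"
  have split: "{m + 1..m + (x + y)} = {m + 1..m + x} \<union> {m + x + 1..m + (x + y)}"
    by auto
  have "(\<Sum>i\<in>{m + 1..m + (x + y)}. ?s i) =
      (\<Sum>i\<in>{m + 1..m + x}. ?s i) + (\<Sum>i\<in>{m + x + 1..m + (x + y)}. ?s i)"
    unfolding split by (rule sum.union_disjoint) auto
  also have "\<dots> = x * nat a + y * (nat a + 1)"
    by simp
  \<comment> \<open>The hypothesis is an equation of integers, so the comparison is made under
    \<open>int\<close>, where \<open>0 \<le> a\<close> turns \<open>int (nat a)\<close> into
    \<open>a\<close>.\<close>
  also have "int \<dots> = int (card S)"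
    using assms by (simp add: algebra_simps)
  finally have "card S = (\<Sum>i\<in>{m + 1..m + (x + y)}. ?s i)"
    by (simp only: of_nat_eq_iff)
  from exists_map_with_fibre_cards[OF _ assms(1) this] obtain f where
    "f ` S \<subseteq> {m + 1..m + (x + y)}"
    "\<forall>i\<in>{m + 1..m + (x + y)}. card {v \<in> S. f v = i} = ?s i"
    by auto
  then show ?thesis
    using assms(2) by (intro exI[of _ f]) auto
qed

text \<open>Without arcs a vertex reaches only itself, so any two vertices coincide; that there is a
  vertex at all is part of \<open>strongly_connected\<close>.\<close>

lemma arcless_strongly_connected_is_vertex:
  assumes "strongly_connected H" "arcs H = {}"
  obtains v where "verts H = {v}"
proof -
  have "u = v" if "u \<in> verts H" "v \<in> verts H" for u v
  proof -
    have "u \<rightarrow>\<^sup>*\<^bsub>H\<^esub> v"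
      using assms(1) that by (simp add: strongly_connected_def)
    moreover have "arcs_ends H = {}"
      using assms(2) by (simp add: arcs_ends_def)
    ultimately show "u = v"
      by (auto simp: reachable_def elim: rtrancl_on.cases)
  qed
  then show thesis
    using assms(1) that by (metis all_not_in_conv is_singletonI' is_singleton_def strongly_connected_def)
qed

lemma single_vertex_graph_props:
  fixes H :: "('a, 'b) pre_digraph"
  assumes "wf_digraph H" "verts H = {v}" "arcs H = {}"
  shows "undirected_tree H" "max_degree H = 0" "diameter H \<le> 0"
proof -
  interpret wf_digraph H by fact
  have "connected H"
    using assms(2,3) unfolding connected_def strongly_connected_def
    by (auto simp: mk_symmetric_def reachable_def)
  moreover have "undirected_forest H"
    using assms(3) by (auto simp: undirected_forest_def cycle_def awalk_def)
  ultimately show "undirected_tree H"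
    by (simp add: undirected_tree_def)
  show "max_degree H = 0"
    using assms(2,3) by (simp add: max_degree_def out_degree_def out_arcs_def)
  \<comment> \<open>The empty walk costs 0, and one walk suffices to bound the distance from
    above.\<close>
  have "awalk v [] v"
    using assms(2) by (simp add: awalk_Nil_iff)
  from min_cost_le_walk_cost[OF this, of "\<lambda>_. 1"] show "diameter H \<le> 0"
    using assms(2) by (simp add: diameter_def zero_ereal_def)
qed

text \<open>Each component of an arcless class is a single vertex, whose degree and diameter are
  bounded by 0 and hence by \<open>k\<close> and \<open>d\<close>.\<close>

lemma independent_classes_tree_coloring:
  assumes "coloring G t f"
    and "\<And>i. i \<in> {1..t} \<Longrightarrow> arcs (G \<restriction> color_class G f i) = {}"
  shows "tree_coloring G t k d f"
  unfolding tree_coloring_def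
proof (intro conjI ballI)
  fix i H
  assume i: "i \<in> {1..t}" and "H \<in> pre_digraph.sccs (G \<restriction> color_class G f i)"
  then have ind: "induced_subgraph H (G \<restriction> color_class G f i)" and "strongly_connected H"
    by (auto simp: pre_digraph.sccs_def)
  have "wf_digraph H" "arcs H = {}"
    using ind assms(2)[OF i] by (auto simp: induced_subgraph_def subgraph_def)
  moreover obtain v where "verts H = {v}"
    using arcless_strongly_connected_is_vertex \<open>strongly_connected H\<close> \<open>arcs H = {}\<close> .
  ultimately have *: "undirected_tree H" "max_degree H = 0" "diameter H \<le> 0"
    by (auto intro: single_vertex_graph_props)
  show "undirected_tree H" by fact
  show "max_degree H \<le> k" using * by simp
  show "diameter H \<le> ereal (real d)" using *(3) by (rule order_trans) simp
qed fact

theorem theorem4p1: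
  fixes G :: "('a, 'b) pre_digraph"
    and n k d x1 y1 x2 y2 z1 z2 :: nat
    and a :: int
  assumes "n \<ge> 1" and "k \<ge> 1" and "d \<ge> 1"
    and "complete_bipartite_digraph n n G"
    and "a * int x1 + (a + 1) * int y1 = int n"
    and "a * int x2 + (a + 1) * int y2 = int n"
    and "z1 = x1 + y1" and "z2 = x2 + y2"
  shows "\<exists>f. tree_coloring G (z1 + z2) k d f \<and> equitable G (z1 + z2) f \<and>
    (\<forall>i\<in>{1..z1 + z2}. int (card (color_class G f i)) = a \<or>
                       int (card (color_class G f i)) = a + 1)"
proof -
  obtain U V where UV: "verts G = U \<union> V" "U \<inter> V = {}" "card U = n" "card V = n"
      "arcs_ends G = U \<times> V \<union> V \<times> U"
    using assms(4) unfolding complete_bipartite_digraph_def by auto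
  \<comment> \<open>An infinite set has \<open>card\<close> 0, so \<open>n \<ge> 1\<close> forces
    finiteness.\<close>
  have fin: "finite U" "finite V"
    using UV(3,4) assms(1) by (auto intro: card_ge_0_finite)
  \<comment> \<open>If \<open>a\<close> were negative, then \<open>a + 1 \<le> 0\<close> as well,
    and the left side of the first equation could not reach \<open>n \<ge> 1\<close>.\<close>
  have "0 \<le> a"
  proof (rule ccontr)
    assume "\<not> 0 \<le> a"
    then have "a * int x1 \<le> 0" "(a + 1) * int y1 \<le> 0"
      by (auto intro: mult_nonpos_nonneg)
    then show False
      using assms(1,5) by linarith
  qed
  obtain g where g: "g ` U \<subseteq> {1..z1}"
      "\<And>i. i \<in> {1..z1} \<Longrightarrow> int (card {v \<in> U. g v = i}) \<in> {a, a + 1}"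
    using exists_near_equal_partition[OF fin(1) \<open>0 \<le> a\<close>, of x1 y1 0] UV(3) assms(5,7) by auto
  \<comment> \<open>The offset is now \<open>z1\<close>, so the colors of \<open>V\<close> start
    just after those of \<open>U\<close>.\<close>
  obtain h where h: "h ` V \<subseteq> {z1 + 1..z1 + z2}"
      "\<And>i. i \<in> {z1 + 1..z1 + z2} \<Longrightarrow> int (card {v \<in> V. h v = i}) \<in> {a, a + 1}"
    using exists_near_equal_partition[OF fin(2) \<open>0 \<le> a\<close>, of x2 y2 z1] UV(4) assms(6,8) by auto
  define f where "f v = (if v \<in> U then g v else h v)" for v
  have fU: "f v \<in> {1..z1}" if "v \<in> U" for v
    using that g(1) by (auto simp: f_def)
  have fV: "f v \<in> {z1 + 1..z1 + z2}" if "v \<in> V" for v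
    using that h(1) UV(2) by (auto simp: f_def)
  have cU: "color_class G f i = {v \<in> U. g v = i}" if "i \<in> {1..z1}" for i
    using that fV UV(1) by (fastforce simp: color_class_def f_def)
  have cV: "color_class G f i = {v \<in> V. h v = i}" if "i \<in> {z1 + 1..z1 + z2}" for i
    using that fU UV(1,2) by (fastforce simp: color_class_def f_def)
  have cases: "i \<in> {1..z1} \<or> i \<in> {z1 + 1..z1 + z2}" if "i \<in> {1..z1 + z2}" for i
    using that by auto
  have sizes: "int (card (color_class G f i)) \<in> {a, a + 1}" if "i \<in> {1..z1 + z2}" for i
    using cases[OF that] g(2) h(2) cU cV by fastforce
  have "coloring G (z1 + z2) f"
    unfolding coloring_def UV(1) using fU fV by fastforce
  \<comment> \<open>Every arc joins \<open>U\<close> to \<open>V\<close>, and the palettes of these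
    parts are disjoint, so its ends never share a color.\<close>
  moreover have "arcs (G \<restriction> color_class G f i) = {}" for i
  proof (rule ccontr)
    assume "arcs (G \<restriction> color_class G f i) \<noteq> {}"
    then obtain e where e: "e \<in> arcs G" "f (tail G e) = i" "f (head G e) = i"
      by (auto simp: induce_subgraph_def color_class_def)
    then have "(tail G e, head G e) \<in> U \<times> V \<union> V \<times> U"
      using UV(5) by (auto simp: arcs_ends_def arc_to_ends_def)
    then show False
      using fU fV e(2,3) by fastforce
  qed
  ultimately have "tree_coloring G (z1 + z2) k d f"
    by (intro independent_classes_tree_coloring)
  moreover have "equitable G (z1 + z2) f"
    unfolding equitable_def
  proof (intro ballI)
    fix i j
    assume "i \<in> {1..z1 + z2}" "j \<in> {1..z1 + z2}"
    from this[THEN sizes]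
    show "\<bar>int (card (color_class G f i)) - int (card (color_class G f j))\<bar> \<le> 1"
      by auto
  qed
  ultimately show ?thesis
    using sizes by blast
qed

end
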